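(* Let $F$ be a free group and let $\mathcal{P}$ be an abstract property of subgroups of $F$. (i) If $\mathcal{P}$ is intersection closed, then every subgroup $H\le F$ admits a well defined $\mathcal{P}$-closure. (ii) If $\mathcal{P}$ is finite intersection closed and free factor closed, then every finitely generated subgroup $H\le F$ admits a well defined $\mathcal{P}$-closure. (iii) If $\mathcal{P}$-closures are well defined and $\mathcal{P}$ is free factor closed, then for every subgroup $H\le F$ the extension $H\le \mathrm{cl}_{\mathcal{P}}(H)$ is algebraic. In particular, if $H$ is finitely generated, then so is $\mathrm{cl}_{\mathcal{P}}(H)$.
   Context: An abstract property of subgroups of $F$ is a set $\mathcal{P}$ of subgroups of $F$ containing at least $F$ itself; $H$ satisfies $\mathcal{P}$ if $H\in\mathcal{P}$. $\mathcal{P}$ is intersection closed (resp. finite intersection closed) if the intersection of any family (resp. any finite family) of subgroups satisfying $\mathcal{P}$ satisfies $\mathcal{P}$. $\mathcal{P}$ is free factor closed if every free factor of a subgroup satisfying $\mathcal{P}$ satisfies $\mathcal{P}$. If there is a unique minimal (i.e. a least) subgroup of $F$ satisfying $\mathcal{P}$ and containing $H$, it is called the $\mathcal{P}$-closure of $H$, written $\mathrm{cl}_{\mathcal{P}}(H)$, and $H$ is said to admit a well defined $\mathcal{P}$-closure; $\mathcal{P}$-closures are well defined if this holds for every subgroup $H\le F$. A subgroup $L$ of $K$ is a free factor of $K$ if $K=L*M$ for some $M\le K$. For free groups $H\le K$, the extension $H\le K$ is algebraic if every $x\in K$ is $K$-algebraic over $H$, i.e. lies in every free factor of $K$ that contains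 $H$. *)

theory Defs
  imports "HOL-Algebra.Generated_Groups"
begin

definition list_prod :: "('a, 'b) monoid_scheme \<Rightarrow> 'a list \<Rightarrow> 'a" where
  "list_prod G xs = foldr (\<lambda>x y. x \<otimes>\<^bsub>G\<^esub> y) xs \<one>\<^bsub>G\<^esub>"


section \<open>Free groups\<close>

text \<open>The letter \<open>(x, True)\<close> stands for \<open>x\<close> and \<open>(x, False)\<close> for its inverse.\<close>

definition letter_value :: "('a, 'b) monoid_scheme \<Rightarrow> 'a \<times> bool \<Rightarrow> 'a" where
  "letter_value G l = (if snd l then fst l else inv\<^bsub>G\<^esub> (fst l))"

definition reduced_group_words :: "'a set \<Rightarrow> ('a \<times> bool) list set" where
  "reduced_group_words X =
     {w. fst ` set w \<subseteq> X \<and> successively (\<lambda>l l'. \<not> (fst l = fst l' \<and> snd l \<noteq> snd l')) w}"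

definition free_basis :: "('a, 'b) monoid_scheme \<Rightarrow> 'a set \<Rightarrow> bool" where
  "free_basis G X \<longleftrightarrow> X \<subseteq> carrier G \<and>
     (\<forall>g\<in>carrier G. \<exists>!w. w \<in> reduced_group_words X \<and> list_prod G (map (letter_value G) w) = g)"

definition free_group :: "('a, 'b) monoid_scheme \<Rightarrow> bool" where
  "free_group G \<longleftrightarrow> group G \<and> (\<exists>X. free_basis G X)"


section \<open>Free factors\<close>

text \<open>Syllables are tagged by the factor they come from (\<open>Inl\<close> for \<open>L\<close>, \<open>Inr\<close> for \<open>M\<close>).
  A common non-trivial element of \<open>L\<close> and \<open>M\<close> thus has two different normal forms,
  so that uniqueness of normal forms forces \<open>L\<close> and \<open>M\<close> to intersect trivially.\<close>

definition free_product_words ::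
  "('a, 'b) monoid_scheme \<Rightarrow> 'a set \<Rightarrow> 'a set \<Rightarrow> ('a + 'a) list set" where
  "free_product_words G L M =
     {w. set w \<subseteq> Inl ` (L - {\<one>\<^bsub>G\<^esub>}) \<union> Inr ` (M - {\<one>\<^bsub>G\<^esub>}) \<and>
         successively (\<lambda>u v. isl u \<noteq> isl v) w}"

text \<open>\<open>K = L * M\<close>, as an internal free product: every element of \<open>K\<close> has a unique normal form.\<close>

definition is_free_product :: "('a, 'b) monoid_scheme \<Rightarrow> 'a set \<Rightarrow> 'a set \<Rightarrow> bool" where
  "is_free_product K L M \<longleftrightarrow> subgroup L K \<and> subgroup M K \<and>
     (\<forall>k\<in>carrier K. \<exists>!w. w \<in> free_product_words K L M \<and>
        list_prod K (map (case_sum id id) w) = k)"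

definition free_factor :: "'a set \<Rightarrow> ('a, 'b) monoid_scheme \<Rightarrow> bool" where
  "free_factor L K \<longleftrightarrow> (\<exists>M. is_free_product K L M)"


section \<open>Algebraic extensions\<close>

definition algebraic_element :: "('a, 'b) monoid_scheme \<Rightarrow> 'a set \<Rightarrow> 'a \<Rightarrow> bool" where
  "algebraic_element K H x \<longleftrightarrow> x \<in> carrier K \<and> (\<forall>L. free_factor L K \<and> H \<subseteq> L \<longrightarrow> x \<in> L)"

definition algebraic_extension :: "'a set \<Rightarrow> ('a, 'b) monoid_scheme \<Rightarrow> bool" where
  "algebraic_extension H K \<longleftrightarrow> subgroup H K \<and> (\<forall>x\<in>carrier K. algebraic_element K H x)"


section \<open>Abstract properties of subgroups and their closures\<close>

definition fin_gen_subgroup :: "'a set \<Rightarrow> ('a, 'b) monoid_scheme \<Rightarrow> bool" where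
  "fin_gen_subgroup H F \<longleftrightarrow> (\<exists>S. finite S \<and> S \<subseteq> carrier F \<and> H = generate F S)"

definition abstract_property :: "('a, 'b) monoid_scheme \<Rightarrow> 'a set set \<Rightarrow> bool" where
  "abstract_property F \<P> \<longleftrightarrow> (\<forall>H\<in>\<P>. subgroup H F) \<and> carrier F \<in> \<P>"

text \<open>Only non-empty families are considered below: the empty intersection of subgroups of \<open>F\<close>
  is \<open>F\<close>, which satisfies every abstract property (whereas \<open>\<Inter>{} = UNIV\<close>).\<close>

definition intersection_closed :: "'a set set \<Rightarrow> bool" where
  "intersection_closed \<P> \<longleftrightarrow> (\<forall>\<A>. \<A> \<subseteq> \<P> \<and> \<A> \<noteq> {} \<longrightarrow> \<Inter>\<A> \<in> \<P>)"

definition finite_intersection_closed :: "'a set set \<Rightarrow> bool" where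
  "finite_intersection_closed \<P> \<longleftrightarrow>
     (\<forall>\<A>. finite \<A> \<and> \<A> \<subseteq> \<P> \<and> \<A> \<noteq> {} \<longrightarrow> \<Inter>\<A> \<in> \<P>)"

definition free_factor_closed :: "('a, 'b) monoid_scheme \<Rightarrow> 'a set set \<Rightarrow> bool" where
  "free_factor_closed F \<P> \<longleftrightarrow> (\<forall>K\<in>\<P>. \<forall>L. free_factor L (F\<lparr>carrier := K\<rparr>) \<longrightarrow> L \<in> \<P>)"

definition is_closure :: "'a set set \<Rightarrow> 'a set \<Rightarrow> 'a set \<Rightarrow> bool" where
  "is_closure \<P> H C \<longleftrightarrow> C \<in> \<P> \<and> H \<subseteq> C \<and> (\<forall>K\<in>\<P>. H \<subseteq> K \<longrightarrow> C \<subseteq> K)"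

definition admits_closure :: "'a set set \<Rightarrow> 'a set \<Rightarrow> bool" where
  "admits_closure \<P> H \<longleftrightarrow> (\<exists>C. is_closure \<P> H C)"

definition cl :: "'a set set \<Rightarrow> 'a set \<Rightarrow> 'a set" where
  "cl \<P> H = (THE C. is_closure \<P> H C)"

definition closures_well_defined :: "('a, 'b) monoid_scheme \<Rightarrow> 'a set set \<Rightarrow> bool" where
  "closures_well_defined F \<P> \<longleftrightarrow> (\<forall>H. subgroup H F \<longrightarrow> admits_closure \<P> H)"

end

theory Submission imports Defs "HOL-Algebra.Group_Action" begin

text \<open>
  Everything beyond order theory rests on a weak form of Takahasi's theorem: for finitely generated
  \<open>H\<close> there are finitely many finitely generated subgroups such that every \<open>K \<ge> H\<close> has one of them
  as a free factor containing \<open>H\<close>. Let \<open>W\<close> be the finite set of values of suffixes of words for the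
  generators of \<open>H\<close>. The image of \<open>W\<close> in the Schreier coset graph of \<open>K\<close> spans a finite subgraph
  whose fundamental group \<open>L\<close> contains \<open>H\<close>; it is generated by the \<open>p\<inverse>q \<in> K\<close> with \<open>p, q \<in> W\<close>, which
  leaves only finitely many possibilities for \<open>L\<close>.

  A complement \<open>M\<close> of \<open>L\<close> in \<open>K\<close> is generated by the labels of the edges outside that subgraph, with
  respect to a forest joining all other vertices to it. Uniqueness of normal forms is
  van der Waerden's trick: by the universal property \<open>F\<close> acts on pairs of a group element and a
  normal form, each edge multiplying the normal form by its label, and the element of \<open>K\<close>
  with normal form \<open>w\<close> takes \<open>(1, [])\<close> to a pair with second component \<open>w\<close>.
\<close>


section \<open>The universal property of free groups\<close>

lemma list_prod_Nil [simp]: "list_prod G [] = \<one>\<^bsub>G\<^esub>"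
  and list_prod_Cons [simp]: "list_prod G (x # xs) = x \<otimes>\<^bsub>G\<^esub> list_prod G xs"
  by (simp_all add: list_prod_def)

lemma list_prod_carrier_update [simp]: "list_prod (G\<lparr>carrier := A\<rparr>) xs = list_prod G xs"
  by (simp add: list_prod_def)

abbreviation word_value :: "('a, 'b) monoid_scheme \<Rightarrow> ('a \<times> bool) list \<Rightarrow> 'a" where
  "word_value G w \<equiv> list_prod G (map (letter_value G) w)"

context group
begin

lemma list_prod_closed [simp, intro]: "set xs \<subseteq> carrier G \<Longrightarrow> list_prod G xs \<in> carrier G"
  by (induction xs) auto

lemma list_prod_append:
  "set xs \<subseteq> carrier G \<Longrightarrow> set ys \<subseteq> carrier G \<Longrightarrow>
    list_prod G (xs @ ys) = list_prod G xs \<otimes> list_prod G ys"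
  by (induction xs) (auto simp: m_assoc)

lemma letter_value_closed [simp, intro]: "fst l \<in> carrier G \<Longrightarrow> letter_value G l \<in> carrier G"
  by (simp add: letter_value_def)

lemma letter_value_cancel:
  "fst l \<in> carrier G \<Longrightarrow> fst l = fst l' \<Longrightarrow> snd l \<noteq> snd l' \<Longrightarrow>
    letter_value G l \<otimes> letter_value G l' = \<one>"
  by (auto simp: letter_value_def)

lemma word_value_closed [intro]: "fst ` set w \<subseteq> carrier G \<Longrightarrow> word_value G w \<in> carrier G"
  by (rule list_prod_closed) auto

lemma word_value_append:
  "fst ` set v \<subseteq> carrier G \<Longrightarrow> fst ` set w \<subseteq> carrier G \<Longrightarrow>
    word_value G (v @ w) = word_value G v \<otimes> word_value G w"
  unfolding map_append by (rule list_prod_append) auto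

lemma inv_mult_eq_iff:
  "a \<in> carrier G \<Longrightarrow> b \<in> carrier G \<Longrightarrow> c \<in> carrier G \<Longrightarrow> inv a \<otimes> b = c \<longleftrightarrow> b = a \<otimes> c"
  by (metis inv_closed inv_solve_left)

end

text \<open>Cancelling two mutually inverse letters changes neither the value in \<open>G\<close>
  nor the value of the image word in \<open>G'\<close>, so a single reduction serves both. This
  makes evaluation in \<open>G'\<close> well defined on elements of \<open>G\<close>.\<close>

lemma word_reduction:
  assumes "group G" "group G'" "X \<subseteq> carrier G" "f \<in> X \<rightarrow> carrier G'" "fst ` set w \<subseteq> X"
  shows "\<exists>w'\<in>reduced_group_words X. word_value G w' = word_value G w \<and>
    word_value G' (map (apfst f) w') = word_value G' (map (apfst f) w)"
  using assms(5)
proof (induction w)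
  case Nil
  then show ?case by (intro bexI[of _ "[]"]) (auto simp: reduced_group_words_def)
next
  case (Cons l w)
  interpret G: group G by fact
  interpret G': group G' by fact
  from Cons obtain w' where w': "w' \<in> reduced_group_words X" "word_value G w' = word_value G w"
    "word_value G' (map (apfst f) w') = word_value G' (map (apfst f) w)" by auto
  have l: "fst l \<in> X" using Cons.prems by auto
  show ?case
  \<comment> \<open>As \<open>w'\<close> is already reduced, the new letter can cancel only against
    its head, and what remains is still reduced.\<close>
  proof (cases "\<exists>l' v. w' = l' # v \<and> fst l = fst l' \<and> snd l \<noteq> snd l'")
    case True
    then obtain l' v where v: "w' = l' # v" "fst l = fst l'" "snd l \<noteq> snd l'" by blast
    have vr: "v \<in> reduced_group_words X"
      using w'(1) v by (cases v) (auto simp: reduced_group_words_def)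
    then have v1: "fst ` set v \<subseteq> X" by (simp add: reduced_group_words_def)
    then have v2: "fst ` set v \<subseteq> carrier G" "fst ` set (map (apfst f) v) \<subseteq> carrier G'"
      using assms(3,4) by (auto simp: image_subset_iff)
    have 1: "word_value G (l # w) = word_value G v"
    proof -
      have "word_value G (l # w) = letter_value G l \<otimes>\<^bsub>G\<^esub> (letter_value G l' \<otimes>\<^bsub>G\<^esub> word_value G v)"
        using w' v by simp
      also have "\<dots> = (letter_value G l \<otimes>\<^bsub>G\<^esub> letter_value G l') \<otimes>\<^bsub>G\<^esub> word_value G v"
        using l v assms(3) v2 by (intro G.m_assoc[symmetric]) auto
      also have "\<dots> = word_value G v"
        using l v assms(3) v2 G.word_value_closed[OF v2(1)] by (subst G.letter_value_cancel) auto
      finally show ?thesis .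
    qed
    have 2: "word_value G' (map (apfst f) (l # w)) = word_value G' (map (apfst f) v)"
    proof -
      have "word_value G' (map (apfst f) (l # w)) = letter_value G' (apfst f l) \<otimes>\<^bsub>G'\<^esub>
          (letter_value G' (apfst f l') \<otimes>\<^bsub>G'\<^esub> word_value G' (map (apfst f) v))"
        using w'(3)[symmetric] v by simp
      also have "\<dots> = (letter_value G' (apfst f l) \<otimes>\<^bsub>G'\<^esub> letter_value G' (apfst f l'))
          \<otimes>\<^bsub>G'\<^esub> word_value G' (map (apfst f) v)"
        using l v assms(4) G'.word_value_closed[OF v2(2)]
        by (intro G'.m_assoc[symmetric] G'.letter_value_closed) auto
      also have "\<dots> = word_value G' (map (apfst f) v)"
        using l v assms(4) G'.word_value_closed[OF v2(2)]
        by (subst G'.letter_value_cancel) auto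
      finally show ?thesis .
    qed
    show ?thesis using vr 1 2 by metis
  next
    case False
    then have "l # w' \<in> reduced_group_words X"
      using w'(1) l by (cases w') (auto simp: reduced_group_words_def)
    with w' show ?thesis by (intro bexI[of _ "l # w'"]) auto
  qed
qed

lemma free_basis_word:
  assumes "free_basis G X" "g \<in> carrier G"
  obtains w where "fst ` set w \<subseteq> X" "g = word_value G w"
proof -
  obtain w where "w \<in> reduced_group_words X" "word_value G w = g"
    using assms unfolding free_basis_def by (meson ex1_implies_ex)
  then show thesis by (intro that[of w]) (auto simp: reduced_group_words_def)
qed

text \<open>The map is read off the unique reduced word of an element. By
  \<open>word_reduction\<close> every other word over \<open>X\<close> gives the same value, so
  multiplicativity becomes concatenation of words.\<close>

proposition free_basis_extension:
  assumes "group G" "group G'" "free_basis G X" "f \<in> X \<rightarrow> carrier G'"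
  shows "\<exists>h\<in>hom G G'. \<forall>x\<in>X. h x = f x"
proof -
  interpret G: group G by fact
  interpret G': group G' by fact
  have X: "X \<subseteq> carrier G" using assms(3) by (simp add: free_basis_def)
  define r where "r g = (THE w. w \<in> reduced_group_words X \<and> word_value G w = g)" for g
  define h where "h g = word_value G' (map (apfst f) (r g))" for g
  have r: "r (word_value G w) = w" if "w \<in> reduced_group_words X" for w
  proof -
    have "word_value G w \<in> carrier G"
      using that X by (intro G.word_value_closed) (auto simp: reduced_group_words_def)
    then show ?thesis
      unfolding r_def using assms(3) that by (intro the1_equality) (auto simp: free_basis_def)
  qed
  have h: "h (word_value G w) = word_value G' (map (apfst f) w)" if w: "fst ` set w \<subseteq> X" for w
  proof -
    obtain w' where "w' \<in> reduced_group_words X" "word_value G w' = word_value G w"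
      "word_value G' (map (apfst f) w') = word_value G' (map (apfst f) w)"
      using word_reduction[OF assms(1,2) X assms(4) w] by blast
    then show ?thesis using r[of w'] by (simp add: h_def)
  qed
  have cl: "fst ` set (map (apfst f) w) \<subseteq> carrier G'" if "fst ` set w \<subseteq> X" for w
    using that assms(4) by (auto simp: image_subset_iff)
  have "h \<in> hom G G'"
  proof (rule homI)
    fix g assume "g \<in> carrier G"
    then obtain w where "fst ` set w \<subseteq> X" "g = word_value G w"
      by (rule free_basis_word[OF assms(3)])
    then show "h g \<in> carrier G'" by (simp only: h G'.word_value_closed[OF cl])
  next
    fix g g' assume "g \<in> carrier G" "g' \<in> carrier G"
    obtain v w where vw: "fst ` set v \<subseteq> X" "g = word_value G v"
        "fst ` set w \<subseteq> X" "g' = word_value G w"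
      by (rule free_basis_word[OF assms(3) \<open>g \<in> carrier G\<close>],
          rule free_basis_word[OF assms(3) \<open>g' \<in> carrier G\<close>])
    have "fst ` set v \<subseteq> carrier G" "fst ` set w \<subseteq> carrier G" using vw X by auto
    then have "g \<otimes>\<^bsub>G\<^esub> g' = word_value G (v @ w)"
      unfolding vw by (rule G.word_value_append[symmetric])
    then have "h (g \<otimes>\<^bsub>G\<^esub> g') = word_value G' (map (apfst f) (v @ w))"
      using h[of "v @ w"] vw by (simp add: image_Un)
    also have "\<dots> = h g \<otimes>\<^bsub>G'\<^esub> h g'"
      unfolding vw(2,4) h[OF vw(1)] h[OF vw(3)] map_append[of "apfst f"]
      by (rule G'.word_value_append[OF cl[OF vw(1)] cl[OF vw(3)]])
    finally show "h (g \<otimes>\<^bsub>G\<^esub> g') = h g \<otimes>\<^bsub>G'\<^esub> h g'" .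
  qed
  moreover have "h x = f x" if "x \<in> X" for x
  proof -
    have "x \<in> carrier G" "f x \<in> carrier G'" using that X assms(4) by auto
    then show ?thesis using h[of "[(x, True)]"] that by (simp add: letter_value_def)
  qed
  ultimately show ?thesis by blast
qed

text \<open>The universal property is applied to the symmetric group on \<open>S\<close>: a basis
  imposes no relations, so the bijections are arbitrary. They are restricted to \<open>S\<close>
  because \<open>BijGroup\<close> consists of extensional maps.\<close>

corollary free_basis_action:
  assumes "group G" "free_basis G X" "\<And>x. x \<in> X \<Longrightarrow> bij_betw (f x) S S"
  shows "\<exists>\<phi>. group_action G S \<phi> \<and> (\<forall>x\<in>X. \<forall>s\<in>S. \<phi> x s = f x s)"
proof -
  have "(\<lambda>x. restrict (f x) S) \<in> X \<rightarrow> carrier (BijGroup S)"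
    using assms(3) by (auto simp: BijGroup_def Bij_def cong: bij_betw_cong)
  from free_basis_extension[OF assms(1) group_BijGroup assms(2) this]
  obtain \<phi> where "\<phi> \<in> hom G (BijGroup S)" "\<forall>x\<in>X. \<phi> x = restrict (f x) S" by blast
  then show ?thesis
    using assms(1) group_BijGroup
    by (intro exI[of _ \<phi>])
      (auto simp: group_action_def group_hom_def group_hom_axioms_def)
qed


section \<open>Multiplying normal forms by a syllable\<close>

text \<open>The tag \<open>True\<close> selects the left factor \<open>L\<close>, \<open>False\<close> the right factor \<open>M\<close>.\<close>

definition syllable :: "bool \<Rightarrow> 'a \<Rightarrow> 'a + 'a" where
  "syllable b = (if b then Inl else Inr)"

text \<open>The case \<one> is separate because edge labels may be trivial while normal forms
  contain no trivial syllable.\<close>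

definition syllable_mult ::
  "('a, 'b) monoid_scheme \<Rightarrow> bool \<Rightarrow> 'a \<Rightarrow> ('a + 'a) list \<Rightarrow> ('a + 'a) list" where
  "syllable_mult G b a w = (if a = \<one>\<^bsub>G\<^esub> then w else
     case w of [] \<Rightarrow> [syllable b a]
     | v # vs \<Rightarrow>
         if isl v \<noteq> b then syllable b a # w
         else if a \<otimes>\<^bsub>G\<^esub> case_sum id id v = \<one>\<^bsub>G\<^esub> then vs
         else syllable b (a \<otimes>\<^bsub>G\<^esub> case_sum id id v) # vs)"

lemma isl_syllable [simp]: "isl (syllable b a) = b"
  and value_syllable [simp]: "case_sum id id (syllable b a) = a"
  by (simp_all add: syllable_def)

lemma syllable_cases: obtains b a where "v = syllable b a"
  by (metis syllable_def sum.exhaust)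

lemma syllable_mult_one [simp]: "syllable_mult G b \<one>\<^bsub>G\<^esub> w = w"
  by (simp add: syllable_mult_def)

lemma syllable_mult_Nil: "a \<noteq> \<one>\<^bsub>G\<^esub> \<Longrightarrow> syllable_mult G b a [] = [syllable b a]"
  by (simp add: syllable_mult_def)

lemma syllable_mult_Cons:
  "a \<noteq> \<one>\<^bsub>G\<^esub> \<Longrightarrow> syllable_mult G b a (syllable c e # w) =
    (if c \<noteq> b then syllable b a # syllable c e # w
     else if a \<otimes>\<^bsub>G\<^esub> e = \<one>\<^bsub>G\<^esub> then w else syllable b (a \<otimes>\<^bsub>G\<^esub> e) # w)"
  by (simp add: syllable_mult_def)

lemmas syllable_mult_simps = syllable_mult_Nil syllable_mult_Cons

lemma syllable_in_iff:
  "syllable b a \<in> Inl ` A \<union> Inr ` B \<longleftrightarrow> a \<in> (if b then A else B)"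
  by (auto simp: syllable_def)

lemma Nil_in_free_product_words [simp]: "[] \<in> free_product_words G L M"
  by (simp add: free_product_words_def)

lemma Cons_in_free_product_words_iff:
  "syllable b a # w \<in> free_product_words G L M \<longleftrightarrow>
     a \<in> (if b then L else M) \<and> a \<noteq> \<one>\<^bsub>G\<^esub> \<and> w \<in> free_product_words G L M \<and>
     (w \<noteq> [] \<longrightarrow> isl (hd w) \<noteq> b)"
  using syllable_in_iff[of b a "L - {\<one>\<^bsub>G\<^esub>}" "M - {\<one>\<^bsub>G\<^esub>}"]
  by (cases w) (auto simp: free_product_words_def)

lemma syllable_mult_Cons_word:
  assumes "syllable b a # w \<in> free_product_words G L M"
  shows "syllable_mult G b a w = syllable b a # w"
  using assms unfolding Cons_in_free_product_words_iff
  by (auto simp: syllable_mult_def split: list.split)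

context group
begin

context
  fixes L M
  assumes L: "subgroup L G" and M: "subgroup M G"
begin

private lemma factor: "subgroup (if b then L else M) G"
  using L M by simp

private lemma factor_carrier: "a \<in> (if b then L else M) \<Longrightarrow> a \<in> carrier G"
  using subgroup.mem_carrier[OF factor] .

lemma syllable_mult_closed:
  assumes a: "a \<in> (if b then L else M)" and w: "w \<in> free_product_words G L M"
  shows "syllable_mult G b a w \<in> free_product_words G L M"
proof (cases w)
  case Nil
  then show ?thesis using a
    by (cases "a = \<one>") (auto simp: syllable_mult_simps Cons_in_free_product_words_iff)
next
  case (Cons v vs)
  obtain c e where v: "v = syllable c e" by (rule syllable_cases)
  show ?thesis
    using w a subgroup.m_closed[OF factor, of a b e] unfolding Cons v
    by (cases "a = \<one>"; cases "c = b")
       (auto simp: syllable_mult_simps Cons_in_free_product_words_iff)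
qed

text \<open>Each factor acts on normal forms, and only the head syllable \<open>e\<close> matters.
  If \<open>a'\<close> cancels it, the next syllable has the other tag by alternation, so
  \<open>a\<close> is prepended; this agrees with \<open>a \<otimes> a' \<otimes> e = a\<close>. If
  moreover \<open>a \<otimes> a' = \<one>\<close>, then \<open>a = e\<close> and the original word
  returns.\<close>

lemma syllable_mult_mult:
  assumes a: "a \<in> (if b then L else M)" "a' \<in> (if b then L else M)"
    and w: "w \<in> free_product_words G L M"
  shows "syllable_mult G b a (syllable_mult G b a' w) = syllable_mult G b (a \<otimes> a') w"
proof -
  have ac: "a \<in> carrier G" "a' \<in> carrier G" using a factor_carrier by blast+
  have one: "a = e" if "a \<otimes> a' = \<one>" "a' \<otimes> e = \<one>" "e \<in> carrier G" for e
    using that ac by (metis inv_equality inv_inv)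
  show ?thesis
  proof (cases w)
    case Nil
    then show ?thesis using ac by (cases "a = \<one>"; cases "a' = \<one>") (auto simp: syllable_mult_simps)
  next
    case (Cons v vs)
    obtain c e where v: "v = syllable c e" by (rule syllable_cases)
    have ec: "e \<in> (if c then L else M)"
      using w unfolding Cons v Cons_in_free_product_words_iff by simp
    have e: "e \<in> carrier G" "e \<noteq> \<one>"
      using w factor_carrier[OF ec] unfolding Cons v Cons_in_free_product_words_iff by auto
    have assoc: "a \<otimes> (a' \<otimes> e) = a \<otimes> a' \<otimes> e" using ac e by (simp add: m_assoc)
    have *: "a \<otimes> a' \<otimes> e = a" if "a' \<otimes> e = \<one>" using that ac e by (simp flip: assoc)
    have **: "a = e" if "a' \<otimes> e = \<one>" "a \<otimes> a' = \<one>" using one that e by blast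
    have ***: "a' \<otimes> e = \<one> \<Longrightarrow> vs \<noteq> [] \<Longrightarrow> isl (hd vs) \<noteq> c"
      using w unfolding Cons v Cons_in_free_product_words_iff by auto
    show ?thesis
    proof (cases "c = b")
      case False
      then show ?thesis using ac e unfolding Cons v
        by (cases "a = \<one>"; cases "a' = \<one>") (auto simp: syllable_mult_simps)
    next
      case True
      show ?thesis
      proof (cases "a' \<otimes> e = \<one>")
        case t: True
        have "syllable_mult G b a vs = (if a = \<one> then vs else syllable b a # vs)"
          using ***[OF t] True by (cases vs; cases "hd vs" rule: syllable_cases) (auto simp: syllable_mult_simps)
        then show ?thesis
          using t * ** e ac True unfolding Cons v
          by (cases "a = \<one>"; cases "a' = \<one>"; cases "a \<otimes> a' = \<one>") (auto simp: syllable_mult_simps)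
      next
        case False
        then show ?thesis using assoc e ac True unfolding Cons v
          by (cases "a = \<one>"; cases "a' = \<one>"; cases "a \<otimes> a' = \<one>") (auto simp: syllable_mult_simps)
      qed
    qed
  qed
qed

lemma free_product_word_carrier:
  "w \<in> free_product_words G L M \<Longrightarrow> case_sum id id ` set w \<subseteq> carrier G"
  using subgroup.mem_carrier[OF L] subgroup.mem_carrier[OF M]
  by (auto simp: free_product_words_def)

lemma list_prod_syllable_mult:
  assumes a: "a \<in> (if b then L else M)" and w: "w \<in> free_product_words G L M"
  shows "list_prod G (map (case_sum id id) (syllable_mult G b a w)) =
    a \<otimes> list_prod G (map (case_sum id id) w)"
proof -
  have ac: "a \<in> carrier G" using a factor_carrier by blast
  have *: "list_prod G (map (case_sum id id) w) \<in> carrier G"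
    using free_product_word_carrier[OF w] by auto
  show ?thesis
  proof (cases w)
    case Nil
    then show ?thesis using ac by (cases "a = \<one>") (auto simp: syllable_mult_simps)
  next
    case (Cons v vs)
    obtain c e where v: "v = syllable c e" by (rule syllable_cases)
    have "e \<in> carrier G" "list_prod G (map (case_sum id id) vs) \<in> carrier G"
      using free_product_word_carrier[OF w] unfolding Cons v by auto
    then show ?thesis using ac unfolding Cons v
      by (cases "a = \<one>") (auto simp: syllable_mult_simps simp flip: m_assoc)
qed
qed

end
end


section \<open>A free factor from a subgraph of the Schreier coset graph\<close>

text \<open>Vertices are the left cosets \<open>gK\<close>, represented by any of their elements, and \<open>x \<in> X\<close> leads from
  \<open>gK\<close> to \<open>xgK\<close>. The representative \<open>t g\<close> of \<open>gK\<close> lies in \<open>W\<close> whenever \<open>gK\<close> meets \<open>W\<close>; otherwise it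
  continues the representative of a vertex that is closer to \<open>W\<close> in terms of \<open>d\<close>.\<close>

locale coset_graph = group F for F :: "('a, 'b) monoid_scheme" (structure) +
  fixes X K W :: "'a set" and t :: "'a \<Rightarrow> 'a" and d :: "'a \<Rightarrow> nat"
  assumes basis: "free_basis F X"
    and K: "subgroup K F"
    and W_carrier: "W \<subseteq> carrier F"
    and one_W: "\<one> \<in> W"
    and W_suffix: "p \<in> W \<Longrightarrow>
      \<exists>w. fst ` set w \<subseteq> X \<and> p = word_value F w \<and> (\<forall>n. word_value F (drop n w) \<in> W)"
    and t_coset: "g \<in> carrier F \<Longrightarrow> \<exists>k\<in>K. t g = g \<otimes> k"
    and t_mult: "g \<in> carrier F \<Longrightarrow> k \<in> K \<Longrightarrow> t (g \<otimes> k) = t g"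
    and t_one [simp]: "t \<one> = \<one>"
    and t_W: "p \<in> W \<Longrightarrow> t p \<in> W"
    and t_tree: "g \<in> carrier F \<Longrightarrow> t g \<in> W \<or> (\<exists>l. fst l \<in> X \<and>
      d (inv (letter_value F l) \<otimes> g) < d g \<and>
      t g = letter_value F l \<otimes> t (inv (letter_value F l) \<otimes> g))"

text \<open>Shortest paths to the image of \<open>W\<close> form the required forest: a coset that
  misses \<open>W\<close> inherits its representative from a strictly closer neighbour.\<close>

lemma (in group) coset_graph_exists:
  assumes X: "free_basis G X" and K: "subgroup K G" and W: "W \<subseteq> carrier G" "\<one> \<in> W"
    and suffix: "\<And>p. p \<in> W \<Longrightarrow>
      \<exists>w. fst ` set w \<subseteq> X \<and> p = word_value G w \<and> (\<forall>n. word_value G (drop n w) \<in> W)"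
  shows "\<exists>t d. coset_graph G X K W t d"
proof -
  have X_carrier: "X \<subseteq> carrier G" using X by (simp add: free_basis_def)
  \<comment> \<open>\<open>reach C n\<close> says that a word of length \<open>n\<close> leads from
    a point of \<open>W\<close> into \<open>C\<close>, so \<open>D\<close> is the distance to the
    image of \<open>W\<close>. \<open>L C\<close> picks a letter that \<open>step\<close> can
    retrace to a closer coset.\<close>
  define reach where "reach C n \<longleftrightarrow> (\<exists>w. length w = n \<and> fst ` set w \<subseteq> X \<and>
    (\<exists>p\<in>W. word_value G w \<otimes> p \<in> C))" for C n
  define D where "D C = (LEAST n. reach C n)" for C
  define step where "step C l = inv (letter_value G l) <# C" for C l
  define L where "L C = (SOME l. fst l \<in> X \<and> D (step C l) < D C)" for C
  \<comment> \<open>Recursion over cosets, not elements, makes the representative constant on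
    \<open>gK\<close>. Preferring \<one> gives the base vertex the representative \<one>.\<close>
  define T where "T = wfrec (measure D) (\<lambda>f C. if C \<inter> W \<noteq> {}
    then (if \<one> \<in> C then \<one> else SOME p. p \<in> C \<inter> W) else letter_value G (L C) \<otimes> f (step C (L C)))"
  have KG: "K \<subseteq> carrier G" using K by (rule subgroup.subset)
  have lcos_self: "g \<in> g <# K" if "g \<in> carrier G" for g
    unfolding l_coset_def using that subgroup.one_closed[OF K] by (auto intro!: bexI[of _ \<one>])
  have step_coset: "step (g <# K) l = (inv (letter_value G l) \<otimes> g) <# K"
    if "g \<in> carrier G" "fst l \<in> X" for g l
    unfolding step_def using that X_carrier KG by (intro lcos_m_assoc) auto
  have L: "fst (L (g <# K)) \<in> X \<and> D (step (g <# K) (L (g <# K))) < D (g <# K)"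
    if g: "g \<in> carrier G" and out: "(g <# K) \<inter> W = {}" for g
  proof -
    have "g \<in> g <# K" using g by (rule lcos_self)
    \<comment> \<open>A word for \<open>g\<close>, applied to \<one> in \<open>W\<close>, shows that
      the distance is finite.\<close>
    then have "\<exists>n. reach (g <# K) n"
      using free_basis_word[OF X g] g W(2) unfolding reach_def by (metis r_one)
    then have "reach (g <# K) (D (g <# K))" unfolding D_def by (rule LeastI_ex)
    then obtain w p where w: "length w = D (g <# K)" "fst ` set w \<subseteq> X" "p \<in> W"
      "word_value G w \<otimes> p \<in> g <# K" unfolding reach_def by blast
    have p: "p \<in> carrier G" using w W by auto
    show ?thesis
    proof (cases w)
      case Nil
      then show ?thesis using w p out by auto
    next
      case (Cons l v)
      have l: "fst l \<in> carrier G" "fst l \<in> X" and v: "word_value G v \<in> carrier G"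
        using w X_carrier unfolding Cons by (auto intro!: word_value_closed)
      have "inv (letter_value G l) \<otimes> (word_value G w \<otimes> p) \<in> step (g <# K) l"
        using w(4) unfolding step_def l_coset_def by blast
      moreover have "inv (letter_value G l) \<otimes> (word_value G w \<otimes> p) = word_value G v \<otimes> p"
        using l v p by (simp add: Cons m_assoc inv_mult_eq_iff)
      \<comment> \<open>Removing the outermost letter of a shortest word leaves a shorter word into
        the preceding coset.\<close>
      ultimately have "reach (step (g <# K) l) (length v)"
        using w unfolding reach_def Cons by auto
      then have "D (step (g <# K) l) \<le> length v" unfolding D_def by (rule Least_le)
      then have "fst l \<in> X \<and> D (step (g <# K) l) < D (g <# K)"
        using l w(1) unfolding Cons by auto
      then show ?thesis unfolding L_def by (rule someI)
    qed
  qed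
  have T_in: "T C = (if \<one> \<in> C then \<one> else SOME p. p \<in> C \<inter> W)" if "C \<inter> W \<noteq> {}" for C
    unfolding T_def using that by (subst wfrec) auto
  have T_out: "T (g <# K) = letter_value G (L (g <# K)) \<otimes> T (step (g <# K) (L (g <# K)))"
    if "g \<in> carrier G" "(g <# K) \<inter> W = {}" for g
    using L[OF that] that(2) unfolding T_def by (subst wfrec) (auto simp: cut_apply)
  have T_W: "T C \<in> C \<inter> W" if "C \<inter> W \<noteq> {}" for C
    using that W(2) someI_ex[of "\<lambda>p. p \<in> C \<inter> W"] unfolding T_in[OF that] by auto
  have T_coset: "T (g <# K) \<in> g <# K" if "g \<in> carrier G" for g
    using that
  proof (induction "D (g <# K)" arbitrary: g rule: less_induct)
    case less
    show ?case
    proof (cases "(g <# K) \<inter> W = {}")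
      case False
      then show ?thesis using T_W by blast
    next
      case True
      define l where "l = L (g <# K)"
      note l = L[OF less.prems True, folded l_def]
      have lc: "letter_value G l \<in> carrier G" using l X_carrier by auto
      have "T (step (g <# K) l) \<in> step (g <# K) l"
        using less.hyps[of "inv (letter_value G l) \<otimes> g"] l less.prems lc
          step_coset[OF less.prems, of l] by simp
      then have "letter_value G l \<otimes> T (step (g <# K) l) \<in> letter_value G l <# step (g <# K) l"
        unfolding l_coset_def by blast
      moreover have "letter_value G l <# step (g <# K) l = g <# K"
        using lc less.prems KG l by (simp add: step_coset lcos_m_assoc flip: m_assoc)
      ultimately show ?thesis using T_out[OF less.prems True] by (simp add: l_def)
    qed
  qed
  have "coset_graph G X K W (\<lambda>g. T (g <# K)) (\<lambda>g. D (g <# K))"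
  proof (rule coset_graph.intro[OF is_group coset_graph_axioms.intro[OF X K W suffix]])
    fix g assume g: "g \<in> carrier G"
    show "\<exists>k\<in>K. T (g <# K) = g \<otimes> k" using T_coset[OF g] unfolding l_coset_def by auto
    show "T ((g \<otimes> k) <# K) = T (g <# K)" if "k \<in> K" for k
    proof -
      have "g \<otimes> k \<in> g <# K" using that unfolding l_coset_def by blast
      then show ?thesis using l_repr_independence[OF _ g K] by metis
    qed
    show "T (g <# K) \<in> W \<or> (\<exists>l. fst l \<in> X \<and>
        D ((inv (letter_value G l) \<otimes> g) <# K) < D (g <# K) \<and>
        T (g <# K) = letter_value G l \<otimes> T ((inv (letter_value G l) \<otimes> g) <# K))"
    proof (cases "(g <# K) \<inter> W = {}")
      case True
      then show ?thesis using L[OF g True] T_out[OF g True] step_coset[OF g] by metis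
    next
      case False
      then show ?thesis using T_W by blast
    qed
  next
    have "\<one> \<in> \<one> <# K" using K by (simp add: lcos_self)
    then show "T (\<one> <# K) = \<one>" using T_in[of "\<one> <# K"] W(2) by auto
  next
    fix p assume "p \<in> W"
    then have "p \<in> p <# K" using lcos_self K W by auto
    then show "T (p <# K) \<in> W" using \<open>p \<in> W\<close> T_W[of "p <# K"] by blast
  qed
  then show ?thesis by blast
qed

context coset_graph
begin

text \<open>The edge \<open>x\<close> at \<open>gK\<close> belongs to the subgraph spanned by \<open>W\<close>.\<close>

definition inner :: "'a \<Rightarrow> 'a \<Rightarrow> bool" where
  "inner x g \<longleftrightarrow> (\<exists>p\<in>W. \<exists>k\<in>K. x \<otimes> p \<in> W \<and> g = p \<otimes> k)"

text \<open>The loop at \<open>K\<close> that traverses the edge \<open>x\<close> at \<open>gK\<close>.\<close>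

definition edge :: "'a \<Rightarrow> 'a \<Rightarrow> 'a" where
  "edge x g = inv (t (x \<otimes> g)) \<otimes> x \<otimes> t g"

text \<open>The condition \<open>inv p \<otimes> q \<in> K\<close> says that \<open>p\<close> and
  \<open>q\<close> reach the same vertex, so each generator is the loop that goes out along
  \<open>q\<close> and returns along \<open>p\<close>.\<close>

definition L :: "'a set" where
  "L = generate F {inv p \<otimes> q | p q. p \<in> W \<and> q \<in> W \<and> inv p \<otimes> q \<in> K}"

definition M :: "'a set" where
  "M = generate F {edge x g | x g. x \<in> X \<and> g \<in> carrier F \<and> \<not> inner x g}"

section \<open>Edge labels as functions of cosets, and the two factors\<close>

lemma X_carrier: "x \<in> X \<Longrightarrow> x \<in> carrier F"
  using basis by (auto simp: free_basis_def)

lemma K_carrier: "k \<in> K \<Longrightarrow> k \<in> carrier F"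
  using K by (rule subgroup.mem_carrier)

lemma W_closed: "p \<in> W \<Longrightarrow> p \<in> carrier F"
  using W_carrier by auto

lemma inv_mult_cancel [simp]:
  "a \<in> carrier F \<Longrightarrow> b \<in> carrier F \<Longrightarrow> inv a \<otimes> (a \<otimes> b) = b"
  "a \<in> carrier F \<Longrightarrow> b \<in> carrier F \<Longrightarrow> a \<otimes> (inv a \<otimes> b) = b"
  by (simp_all flip: m_assoc)

lemma t_closed [simp]: "g \<in> carrier F \<Longrightarrow> t g \<in> carrier F"
  using t_coset K_carrier by fastforce

lemma inv_t_in_K: "g \<in> carrier F \<Longrightarrow> inv (t g) \<otimes> g \<in> K"
proof -
  assume g: "g \<in> carrier F"
  then obtain k where "k \<in> K" "t g = g \<otimes> k" using t_coset by blast
  then have "inv (t g) \<otimes> g = inv k" using g K_carrier by (simp add: inv_mult_group m_assoc)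
  then show ?thesis using K \<open>k \<in> K\<close> by (simp add: subgroup.m_inv_closed)
qed

lemma inv_in_K_t:
  assumes "g \<in> carrier F" "h \<in> carrier F" "inv g \<otimes> h \<in> K"
  shows "t h = t g"
  using t_mult[OF assms(1,3)] assms(1,2) by simp

lemma mult_t: "g \<in> carrier F \<Longrightarrow> a \<in> carrier F \<Longrightarrow> t (a \<otimes> t g) = t (a \<otimes> g)"
  using inv_in_K_t[of "a \<otimes> t g" "a \<otimes> g"] inv_t_in_K[of g]
  by (simp add: inv_mult_group m_assoc)

lemma t_t [simp]: "g \<in> carrier F \<Longrightarrow> t (t g) = t g"
  using mult_t[of g \<one>] by simp

lemma t_in_K [simp]: "k \<in> K \<Longrightarrow> t k = \<one>"
  using t_mult[of \<one> k] K_carrier by simp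

lemma edge_closed [simp]: "x \<in> carrier F \<Longrightarrow> g \<in> carrier F \<Longrightarrow> edge x g \<in> carrier F"
  by (simp add: edge_def)

text \<open>With \<open>edge_mult\<close>, this makes tag and label of an edge depend only on the
  coset \<open>gK\<close>; the equivariance in \<open>act_shift\<close> rests on it.\<close>

lemma inner_mult:
  assumes "x \<in> carrier F" "g \<in> carrier F" "k \<in> K"
  shows "inner x (g \<otimes> k) \<longleftrightarrow> inner x g"
proof -
  have *: "inner x (g \<otimes> k)" if "inner x g" "g \<in> carrier F" "k \<in> K" for g k
    using that unfolding inner_def
    by (metis K_carrier W_closed m_assoc subgroup.m_closed[OF K])
  have "inner x (g \<otimes> k \<otimes> inv k)" if "inner x (g \<otimes> k)"
    using *[OF that] assms K_carrier subgroup.m_inv_closed[OF K] by simp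
  then show ?thesis using * assms K_carrier by (auto simp: m_assoc)
qed

lemma edge_mult:
  assumes "x \<in> carrier F" "g \<in> carrier F" "k \<in> K"
  shows "edge x (g \<otimes> k) = edge x g"
  using assms t_mult[of "x \<otimes> g" k] by (simp add: edge_def t_mult K_carrier flip: m_assoc)

lemma inner_t: "x \<in> carrier F \<Longrightarrow> g \<in> carrier F \<Longrightarrow> inner x (t g) \<longleftrightarrow> inner x g"
  using t_coset[of g] inner_mult by auto

lemma edge_t: "x \<in> carrier F \<Longrightarrow> g \<in> carrier F \<Longrightarrow> edge x (t g) = edge x g"
  using t_coset[of g] edge_mult by auto

lemma edge_in_K:
  assumes "x \<in> carrier F" "g \<in> carrier F" shows "edge x g \<in> K"
proof -
  have "edge x g = (inv (t (x \<otimes> g)) \<otimes> (x \<otimes> g)) \<otimes> inv (inv (t g) \<otimes> g)"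
    using assms by (simp add: edge_def inv_mult_group m_assoc)
  then show ?thesis
    using inv_t_in_K[of "x \<otimes> g"] inv_t_in_K[of g] K assms
    by (simp add: subgroup.m_closed subgroup.m_inv_closed)
qed

lemma L_gens: "{inv p \<otimes> q | p q. p \<in> W \<and> q \<in> W \<and> inv p \<otimes> q \<in> K} \<subseteq> carrier F"
  using W_carrier by auto

lemma M_gens: "{edge x g | x g. x \<in> X \<and> g \<in> carrier F \<and> \<not> inner x g} \<subseteq> carrier F"
  using X_carrier by auto

lemma L_subgroup: "subgroup L F"
  unfolding L_def using L_gens by (rule generate_is_subgroup)

lemma M_subgroup: "subgroup M F"
  unfolding M_def using M_gens by (rule generate_is_subgroup)

lemma L_subset: "L \<subseteq> K"
  unfolding L_def using K by (intro generate_subgroup_incl) auto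

lemma M_subset: "M \<subseteq> K"
  unfolding M_def using K edge_in_K X_carrier by (intro generate_subgroup_incl) auto

lemma inv_t_W_in_L:
  assumes "p \<in> W" shows "inv (t p) \<otimes> p \<in> L" "inv p \<otimes> t p \<in> L"
proof -
  have pc: "p \<in> carrier F" using assms W_closed by auto
  show 1: "inv (t p) \<otimes> p \<in> L"
    unfolding L_def using assms t_W inv_t_in_K[OF pc] by (intro generate.incl) blast
  have "inv (inv (t p) \<otimes> p) = inv p \<otimes> t p" using pc by (simp add: inv_mult_group)
  then show "inv p \<otimes> t p \<in> L" using subgroup.m_inv_closed[OF L_subgroup 1] by simp
qed

text \<open>Inserting the endpoints \<open>x \<otimes> p\<close> and \<open>p\<close> splits the
  label into two loops, each comparing an element of \<open>W\<close> with its
  representative.\<close>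

lemma edge_W_in_L:
  assumes "p \<in> W" "x \<in> carrier F" "x \<otimes> p \<in> W" shows "edge x p \<in> L"
proof -
  have "edge x p = (inv (t (x \<otimes> p)) \<otimes> (x \<otimes> p)) \<otimes> (inv p \<otimes> t p)"
    using assms W_closed by (simp add: edge_def m_assoc)
  then show ?thesis
    using inv_t_W_in_L assms subgroup.m_closed[OF L_subgroup] by simp
qed

text \<open>This justifies \<open>inner x g\<close> as the tag under which \<open>move\<close>
  multiplies by an edge label.\<close>

lemma edge_in_factor:
  assumes "x \<in> X" "g \<in> carrier F" shows "edge x g \<in> (if inner x g then L else M)"
proof (cases "inner x g")
  case True
  then obtain p k where "p \<in> W" "k \<in> K" "x \<otimes> p \<in> W" "g = p \<otimes> k"
    unfolding inner_def by blast
  then show ?thesis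
    using True edge_W_in_L edge_mult assms X_carrier W_closed by simp
next
  case False
  then show ?thesis unfolding M_def using assms by (auto intro: generate.incl)
qed

section \<open>The action on group elements paired with normal forms\<close>

abbreviation "\<Omega> \<equiv> free_product_words F L M"
abbreviation "S \<equiv> carrier F \<times> \<Omega>"

definition move :: "'a \<Rightarrow> 'a \<times> ('a + 'a) list \<Rightarrow> 'a \<times> ('a + 'a) list" where
  "move x s = (x \<otimes> fst s, syllable_mult F (inner x (fst s)) (edge x (fst s)) (snd s))"

lemmas mult_closed = syllable_mult_closed[OF L_subgroup M_subgroup]
lemmas mult_mult = syllable_mult_mult[OF L_subgroup M_subgroup]

lemma inv_factor: "a \<in> (if b then L else M) \<Longrightarrow> inv a \<in> (if b then L else M)"
  using subgroup.m_inv_closed[OF L_subgroup] subgroup.m_inv_closed[OF M_subgroup] by auto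

lemma move_bij:
  assumes x: "x \<in> X" shows "bij_betw (move x) S S"
proof (rule bij_betwI)
  note xc = X_carrier[OF x]
  \<comment> \<open>The inverse walks the edge backwards: the edge ending at \<open>g\<close> starts
    at \<open>inv x \<otimes> g\<close>, so its tag and label are taken there.\<close>
  let ?g = "\<lambda>s. (inv x \<otimes> fst s, syllable_mult F (inner x (inv x \<otimes> fst s))
     (inv (edge x (inv x \<otimes> fst s))) (snd s))"
  show "move x \<in> S \<rightarrow> S"
    using edge_in_factor[OF x] xc by (auto simp: move_def intro!: mult_closed simp del: if_split)
  show "?g \<in> S \<rightarrow> S"
    using edge_in_factor[OF x] inv_factor xc by (auto intro!: mult_closed simp del: if_split)
  show "?g (move x s) = s" if "s \<in> S" for s
  proof -
    obtain g w where s: "s = (g, w)" "g \<in> carrier F" "w \<in> \<Omega>" using \<open>s \<in> S\<close> by auto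
    note e = edge_in_factor[OF x s(2)]
    show ?thesis using s(2) xc mult_mult[OF inv_factor[OF e] e s(3)]
      by (simp add: s(1) move_def)
  qed
  show "move x (?g s) = s" if "s \<in> S" for s
  proof -
    obtain g w where s: "s = (g, w)" "g \<in> carrier F" "w \<in> \<Omega>" using \<open>s \<in> S\<close> by auto
    have g: "inv x \<otimes> g \<in> carrier F" using s xc by simp
    note e = edge_in_factor[OF x g]
    show ?thesis using s(2) xc mult_mult[OF e inv_factor[OF e] s(3)]
      by (simp add: s(1) move_def)
  qed
qed

definition act :: "'a \<Rightarrow> 'a \<times> ('a + 'a) list \<Rightarrow> 'a \<times> ('a + 'a) list" where
  "act = (SOME \<phi>. group_action F S \<phi> \<and> (\<forall>x\<in>X. \<forall>s\<in>S. \<phi> x s = move x s))"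

lemma act: "group_action F S act" "x \<in> X \<Longrightarrow> s \<in> S \<Longrightarrow> act x s = move x s"
proof -
  have "group_action F S act \<and> (\<forall>x\<in>X. \<forall>s\<in>S. act x s = move x s)"
    unfolding act_def
    using free_basis_action[OF group_axioms basis move_bij] by (rule someI_ex)
  then show "group_action F S act" "x \<in> X \<Longrightarrow> s \<in> S \<Longrightarrow> act x s = move x s" by auto
qed

sublocale act: group_action F S act
  by (rule act)

lemma act_one [simp]: "s \<in> S \<Longrightarrow> act \<one> s = s"
  by (metis act.id_eq_one restrict_apply')

lemma act_inv_act: "g \<in> carrier F \<Longrightarrow> s \<in> S \<Longrightarrow> act (inv g) (act g s) = s"
  using act.orbit_sym_aux by blast

lemma act_act_inv: "g \<in> carrier F \<Longrightarrow> s \<in> S \<Longrightarrow> act g (act (inv g) s) = s"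
  using act_inv_act[of "inv g" s] by simp

lemma act_closed: "g \<in> carrier F \<Longrightarrow> s \<in> S \<Longrightarrow> act g s \<in> S"
  using act.element_image by blast

text \<open>The action is explicit only on basis elements. For inverses, the claims below follow
  from the hypothesis for \<open>g\<close> at the preimage state, provided that the state is kept
  arbitrary.\<close>

lemma basis_induct [consumes 1, case_names basis one mult inv]:
  assumes "g \<in> carrier F" and x: "\<And>x. x \<in> X \<Longrightarrow> P x" and one: "P \<one>"
    and mult: "\<And>g h. g \<in> carrier F \<Longrightarrow> h \<in> carrier F \<Longrightarrow> P g \<Longrightarrow> P h \<Longrightarrow> P (g \<otimes> h)"
    and inv: "\<And>g. g \<in> carrier F \<Longrightarrow> P g \<Longrightarrow> P (inv g)"
  shows "P g"
proof -
  have "P (word_value F w)" if "fst ` set w \<subseteq> X" for w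
    using that
  proof (induction w)
    case (Cons l w)
    have "word_value F w \<in> carrier F" using Cons.prems X_carrier by (intro word_value_closed) auto
    moreover have "fst l \<in> carrier F" "P (letter_value F l)"
      using Cons.prems X_carrier x inv by (auto simp: letter_value_def)
    ultimately show ?case using Cons by (auto intro!: mult)
  qed (simp add: one)
  then show ?thesis using free_basis_word[OF basis assms(1)] by metis
qed

lemma fst_act:
  assumes "g \<in> carrier F" "s \<in> S" shows "fst (act g s) = g \<otimes> fst s"
  using assms
proof (induction arbitrary: s rule: basis_induct)
  case (basis x)
  then show ?case by (simp add: act move_def)
next
  case one
  then show ?case by auto
next
  case (mult g h)
  have "fst s \<in> carrier F" using mult.prems by auto
  then show ?case using mult act_closed[OF mult(2,5)]
    by (simp add: act.composition_rule m_assoc)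
next
  case (inv g)
  define s' where "s' = act (m_inv F g) s"
  have s': "s' \<in> S" "act g s' = s" using inv by (simp_all add: s'_def act_closed act_act_inv)
  have "fst s' \<in> carrier F" using s' by auto
  moreover have "fst s = g \<otimes> fst s'" using inv.IH[OF s'(1)] s'(2) by simp
  ultimately show ?case using inv.hyps by (simp add: s'_def)
qed

text \<open>Shifting the start by \<open>k \<in> K\<close> on the right changes none of the cosets
  visited, so the same labels with the same tags are multiplied onto the normal form.\<close>

lemma act_shift:
  assumes "g \<in> carrier F" "(h, w) \<in> S" "k \<in> K"
  shows "act g (h \<otimes> k, w) = (g \<otimes> h \<otimes> k, snd (act g (h, w)))"
proof -
  have "snd (act g (h \<otimes> k, w)) = snd (act g (h, w))" if "(h, w) \<in> S" for h w
    using assms(1) that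
  proof (induction arbitrary: h w rule: basis_induct)
    case (basis x)
    then show ?case using assms(3) K_carrier X_carrier by (simp add: act move_def inner_mult edge_mult)
  next
    case one
    then show ?case using assms(3) K_carrier by auto
  next
    case (mult g g')
    obtain w' where w': "act g' (h, w) = (g' \<otimes> h, w')"
      using fst_act[of g' "(h, w)"] mult by (metis fst_conv prod.collapse)
    have w'S: "(g' \<otimes> h, w') \<in> S" using act_closed[of g' "(h, w)"] mult w' by simp
    have S': "(h \<otimes> k, w) \<in> S" using mult.prems assms(3) K_carrier by auto
    have "act g' (h \<otimes> k, w) = (g' \<otimes> (h \<otimes> k), w')"
      using fst_act[OF mult(2) S'] mult(4)[OF mult.prems] w' by (metis fst_conv prod.collapse snd_conv)
    moreover have "g' \<otimes> (h \<otimes> k) = g' \<otimes> h \<otimes> k"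
      using mult assms(3) K_carrier by (auto simp: m_assoc)
    ultimately show ?case
      using mult.hyps S' mult(3)[OF w'S] w' mult.prems by (simp add: act.composition_rule)
  next
    case (inv g)
    obtain w' where w': "act (m_inv F g) (h, w) = (m_inv F g \<otimes> h, w')"
      using fst_act[of "m_inv F g" "(h, w)"] inv by (metis fst_conv prod.collapse inv_closed)
    have h: "h \<in> carrier F" "k \<in> carrier F" using inv.prems assms(3) K_carrier by auto
    have w'S: "(m_inv F g \<otimes> h, w') \<in> S" using act_closed[of "m_inv F g" "(h, w)"] inv w' by simp
    have S': "(m_inv F g \<otimes> h \<otimes> k, w') \<in> S" using w'S h by simp
    \<comment> \<open>The hypothesis for \<open>g\<close> is used at this preimage, shifted by
      \<open>k\<close>, and the resulting equation is then inverted.\<close>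
    have undo: "act g (m_inv F g \<otimes> h, w') = (h, w)"
      using act_act_inv[OF inv(1) inv.prems] w' by simp
    have "act g (m_inv F g \<otimes> h \<otimes> k, w') = (h \<otimes> k, w)"
      using fst_act[OF inv(1) S'] inv(2)[OF w'S] undo h inv(1)
      by (intro prod_eqI) (simp_all add: m_assoc)
    then have "act (m_inv F g) (h \<otimes> k, w) = (m_inv F g \<otimes> h \<otimes> k, w')"
      using act_inv_act[OF inv(1) S'] by simp
    then show ?case using w' by simp
  qed
  moreover have "(h \<otimes> k, w) \<in> S" using assms K_carrier by auto
  ultimately show ?thesis using assms fst_act[of g "(h \<otimes> k, w)"] K_carrier
    by (intro prod_eqI) (auto simp: m_assoc)
qed

definition val :: "('a + 'a) list \<Rightarrow> 'a" where
  "val w = list_prod F (map (case_sum id id) w)"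

lemma val_closed: "w \<in> \<Omega> \<Longrightarrow> val w \<in> carrier F"
  unfolding val_def using free_product_word_carrier[OF L_subgroup M_subgroup]
  by (intro list_prod_closed) auto

lemma val_mult: "a \<in> (if b then L else M) \<Longrightarrow> w \<in> \<Omega> \<Longrightarrow> val (syllable_mult F b a w) = a \<otimes> val w"
  unfolding val_def by (rule list_prod_syllable_mult[OF L_subgroup M_subgroup])

text \<open>The label \<open>inv (t (x \<otimes> h)) \<otimes> x \<otimes> t h\<close> is made so
  that sending \<open>(h, w)\<close> to \<open>t h \<otimes> val w\<close> turns the action into
  left multiplication. For \<open>k \<in> K\<close> and start \<open>(\<one>, [])\<close> this
  yields a normal form of \<open>k\<close>.\<close>

lemma val_act:
  assumes "g \<in> carrier F" "(h, w) \<in> S"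
  shows "t (g \<otimes> h) \<otimes> val (snd (act g (h, w))) = g \<otimes> t h \<otimes> val w"
  using assms
proof (induction arbitrary: h w rule: basis_induct)
  case (basis x)
  have "edge x h \<in> (if inner x h then L else M)" using basis by (intro edge_in_factor) auto
  then show ?case using basis X_carrier
    by (simp add: act move_def val_mult val_closed) (simp add: edge_def m_assoc val_closed)
next
  case one
  then show ?case by (auto simp: val_closed)
next
  case (mult g g')
  obtain w' where w': "act g' (h, w) = (g' \<otimes> h, w')"
    using fst_act[of g' "(h, w)"] mult by (metis fst_conv prod.collapse)
  have w'S: "(g' \<otimes> h, w') \<in> S" using act_closed[of g' "(h, w)"] mult w' by simp
  show ?case
    using mult.hyps mult.prems mult(3)[OF w'S] mult(4)[OF mult.prems] w'S
    by (simp add: act.composition_rule w' m_assoc val_closed)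
next
  case (inv g)
  obtain w' where w': "act (m_inv F g) (h, w) = (m_inv F g \<otimes> h, w')"
    using fst_act[of "m_inv F g" "(h, w)"] inv by (metis fst_conv prod.collapse inv_closed)
  have w'S: "(m_inv F g \<otimes> h, w') \<in> S" using act_closed[of "m_inv F g" "(h, w)"] inv w' by simp
  have undo: "act g (m_inv F g \<otimes> h, w') = (h, w)"
    using act_act_inv[OF inv(1) inv.prems] w' by simp
  show ?case
    using inv.hyps inv.prems inv(2)[OF w'S] w'S undo
    by (simp add: w' m_assoc val_closed)
qed

section \<open>Elements of the factors act as single syllables\<close>

text \<open>Inside the image of \<open>W\<close> every edge belongs to \<open>L\<close>, so the edge labels along a path telescope.\<close>

lemma act_W:
  assumes "p \<in> W" "w \<in> \<Omega>"
  shows "act p (\<one>, w) = (p, syllable_mult F True (inv (t p) \<otimes> p) w)"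
proof -
  have "act (word_value F v) (\<one>, w) =
      (word_value F v, syllable_mult F True (inv (t (word_value F v)) \<otimes> word_value F v) w)"
    if "fst ` set v \<subseteq> X" "\<forall>n. word_value F (drop n v) \<in> W" for v
    using that
  proof (induction v)
    case Nil
    then show ?case using assms(2) by simp
  next
    case (Cons l v)
    define q where "q = word_value F v"
    have sub: "word_value F (drop n v) \<in> W" for n using Cons.prems(2) by (metis drop_Suc_Cons)
    have q: "q \<in> W" using sub[of 0] by (simp add: q_def)
    have lq: "letter_value F l \<otimes> q \<in> W" using Cons.prems(2)[rule_format, of 0] by (simp add: q_def)
    have x: "fst l \<in> X" "fst l \<in> carrier F" using Cons.prems X_carrier by auto
    have qc: "q \<in> carrier F" using q W_closed by auto
    have IH: "act q (\<one>, w) = (q, syllable_mult F True (inv (t q) \<otimes> q) w)"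
      using Cons.IH Cons.prems(1) sub by (simp add: q_def)
    \<comment> \<open>One edge traversed forwards inside \<open>W\<close>: its label cancels the old
      representative and introduces the new one.\<close>
    have step: "act x (q', syllable_mult F True (inv (t q') \<otimes> q') w) =
       (x \<otimes> q', syllable_mult F True (inv (t (x \<otimes> q')) \<otimes> (x \<otimes> q')) w)"
      if "x \<in> X" "q' \<in> W" "x \<otimes> q' \<in> W" for x q'
    proof -
      have c: "x \<in> carrier F" "q' \<in> carrier F" using that X_carrier W_closed by auto
      have inn: "inner x q'" unfolding inner_def
        using that c subgroup.one_closed[OF K] by (intro bexI[of _ q'] bexI[of _ \<one>]) auto
      have e: "edge x q' \<in> (if True then L else M)"
        using that c edge_W_in_L by simp
      have i: "inv (t q') \<otimes> q' \<in> (if True then L else M)"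
        using that inv_t_W_in_L by simp
      have "edge x q' \<otimes> (inv (t q') \<otimes> q') = inv (t (x \<otimes> q')) \<otimes> (x \<otimes> q')"
        using c by (simp add: edge_def m_assoc)
      then show ?thesis
        using inn c mult_mult[OF e i assms(2)] act(2)[OF that(1)] mult_closed[OF i assms(2)]
        by (simp add: move_def)
    qed
    have S1: "(\<one>, w) \<in> S" using assms(2) by simp
    have "act (letter_value F l) (act q (\<one>, w)) = (letter_value F l \<otimes> q,
        syllable_mult F True (inv (t (letter_value F l \<otimes> q)) \<otimes> (letter_value F l \<otimes> q)) w)"
    proof (cases "snd l")
      case True
      then show ?thesis using step[of "fst l" q] x q lq by (simp add: IH letter_value_def)
    next
      case False
      then have l: "letter_value F l = inv (fst l)" by (simp add: letter_value_def)
      \<comment> \<open>The inverse letter runs backwards along the edge from \<open>r\<close> to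
        \<open>q\<close>, so \<open>step\<close> is applied at \<open>r\<close> and
        inverted.\<close>
      define r where "r = inv (fst l) \<otimes> q"
      have r: "r \<in> W" "fst l \<otimes> r = q" "r \<in> carrier F" using lq x qc by (simp_all add: l r_def)
      have rL: "inv (t r) \<otimes> r \<in> (if True then L else M)" using inv_t_W_in_L r by simp
      have "act (fst l) (r, syllable_mult F True (inv (t r) \<otimes> r) w) = act q (\<one>, w)"
        using step[of "fst l" r] r x q by (simp add: IH)
      then have "act (inv (fst l)) (act q (\<one>, w)) = (r, syllable_mult F True (inv (t r) \<otimes> r) w)"
        using act_inv_act[OF x(2), of "(r, syllable_mult F True (inv (t r) \<otimes> r) w)"] r
          mult_closed[OF rL assms(2)] by simp
      then show ?thesis by (simp add: l r_def)
    qed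
    then show ?case using x qc S1 by (simp add: act.composition_rule q_def)
  qed
  then show ?thesis using W_suffix[OF assms(1)] by metis
qed

text \<open>Quantifying over all normal forms makes the property closed under products and inverses.
  The base point \<one> suffices, since \<open>act_shift\<close> transports the formula to every
  point of \<open>K\<close>.\<close>

definition regular :: "bool \<Rightarrow> 'a \<Rightarrow> bool" where
  "regular b a \<longleftrightarrow> a \<in> (if b then L else M) \<and> (\<forall>w\<in>\<Omega>. act a (\<one>, w) = (a, syllable_mult F b a w))"

text \<open>After the first of two elements the state sits at a point of \<open>K\<close> instead of
  \<one>; \<open>act_shift\<close> brings it back, and \<open>syllable_mult_mult\<close> composes
  the two multiplications.\<close>

lemma regular_generate:
  assumes "A \<subseteq> carrier F" "\<And>a. a \<in> A \<Longrightarrow> regular b a" "a \<in> generate F A"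
  shows "regular b a"
proof -
  have inv: "regular b (inv a)" if "regular b a" for a
  proof -
    have a: "a \<in> (if b then L else M)" "\<And>w. w \<in> \<Omega> \<Longrightarrow> act a (\<one>, w) = (a, syllable_mult F b a w)"
      using that by (auto simp: regular_def)
    note ia = inv_factor[OF a(1)]
    have c: "a \<in> carrier F" "a \<in> K" using a(1) L_subset M_subset K_carrier by (auto split: if_splits)
    have "act (inv a) (\<one>, w) = (inv a, syllable_mult F b (inv a) w)" if w: "w \<in> \<Omega>" for w
    proof -
      let ?w = "syllable_mult F b (inv a) w"
      have w': "?w \<in> \<Omega>" using mult_closed[OF ia w] .
      have "act a (\<one> \<otimes> inv a, ?w) = (\<one>, w)"
        using act_shift[of a \<one> ?w "inv a"] c w' a(2)[OF w'] mult_mult[OF a(1) ia w]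
          subgroup.m_inv_closed[OF K c(2)] by simp
      then show ?thesis using act_inv_act[OF c(1), of "(inv a, ?w)"] c w' by simp
    qed
    then show ?thesis using ia by (simp add: regular_def)
  qed
  from assms(3) show ?thesis
  proof induction
    case one
    show ?case
      using subgroup.one_closed[OF L_subgroup] subgroup.one_closed[OF M_subgroup]
      by (simp add: regular_def)
  next
    case (incl h)
    then show ?case using assms by blast
  next
    case (inv h)
    then show ?case using assms \<open>\<And>a. regular b a \<Longrightarrow> regular b (m_inv F a)\<close> by blast
  next
    case (eng a a')
    have a: "a \<in> (if b then L else M)" "\<And>w. w \<in> \<Omega> \<Longrightarrow> act a (\<one>, w) = (a, syllable_mult F b a w)"
     and a': "a' \<in> (if b then L else M)" "\<And>w. w \<in> \<Omega> \<Longrightarrow> act a' (\<one>, w) = (a', syllable_mult F b a' w)"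
      using eng.IH by (auto simp: regular_def)
    have c: "a \<in> carrier F" "a' \<in> carrier F" "a' \<in> K"
      using a(1) a'(1) L_subset M_subset K_carrier by (auto split: if_splits)
    have "act (a \<otimes> a') (\<one>, w) = (a \<otimes> a', syllable_mult F b (a \<otimes> a') w)" if w: "w \<in> \<Omega>" for w
    proof -
      let ?w = "syllable_mult F b a' w"
      have w': "?w \<in> \<Omega>" using mult_closed[OF a'(1) w] .
      have "act (a \<otimes> a') (\<one>, w) = act a (\<one> \<otimes> a', ?w)"
        using c w a'(2) by (simp add: act.composition_rule)
      also have "\<dots> = (a \<otimes> a', syllable_mult F b (a \<otimes> a') w)"
        using act_shift[of a \<one> ?w a'] c w' a(2)[OF w'] mult_mult[OF a(1) a'(1) w] by simp
      finally show ?thesis .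
    qed
    moreover have "a \<otimes> a' \<in> (if b then L else M)"
      using a(1) a'(1) subgroup.m_closed[OF L_subgroup] subgroup.m_closed[OF M_subgroup] by auto
    ultimately show ?case by (simp add: regular_def)
  qed
qed

text \<open>For a generator \<open>a = inv p \<otimes> q\<close>, walking \<open>p\<close> from
  \<open>a\<close> ends at \<open>q\<close>, and so does walking \<open>q\<close> from \<one>. By
  \<open>act_W\<close> the normal forms agree as well, because \<open>t p = t q\<close>; applying
  \<open>inv p\<close> isolates the action of \<open>a\<close>.\<close>

lemma regular_L: "a \<in> L \<Longrightarrow> regular True a"
proof (rule regular_generate[OF L_gens, folded L_def])
  fix a assume "a \<in> {inv p \<otimes> q | p q. p \<in> W \<and> q \<in> W \<and> inv p \<otimes> q \<in> K}"
  then obtain p q where a: "a = inv p \<otimes> q" "p \<in> W" "q \<in> W" "a \<in> K" by auto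
  then have c: "p \<in> carrier F" "q \<in> carrier F" "a \<in> carrier F" using W_closed K_carrier by auto
  have pa: "p \<otimes> a = q" using c a by simp
  have tq: "t q = t p" using t_mult[OF c(1) a(4)] pa by simp
  have aL: "a \<in> (if True then L else M)" unfolding L_def using a by (auto intro: generate.incl)
  have pL: "inv (t p) \<otimes> p \<in> (if True then L else M)" using inv_t_W_in_L a by simp
  have "act a (\<one>, w) = (a, syllable_mult F True a w)" if w: "w \<in> \<Omega>" for w
  proof -
    let ?w = "syllable_mult F True a w"
    have w': "?w \<in> \<Omega>" using mult_closed[OF aL w] .
    have "act p (\<one> \<otimes> a, ?w) = (q, syllable_mult F True (inv (t p) \<otimes> p \<otimes> a) w)"
      using act_shift[of p \<one> ?w a] c a w' act_W[OF a(2) w'] mult_mult[OF pL aL w] pa by simp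
    also have "inv (t p) \<otimes> p \<otimes> a = inv (t q) \<otimes> q"
      using c tq pa by (simp add: m_assoc)
    also have "(q, syllable_mult F True (inv (t q) \<otimes> q) w) = act q (\<one>, w)"
      using act_W[OF a(3) w] by simp
    finally have "act (inv p) (act q (\<one>, w)) = (a, ?w)"
      using act_inv_act[OF c(1), of "(\<one> \<otimes> a, ?w)"] c w' by simp
    then show ?thesis using c a w by (simp add: act.composition_rule)
  qed
  then show "regular True a" using aL by (simp add: regular_def)
qed

text \<open>Forest edges have label \<open>\<one>\<close>, so running along a representative changes no normal form.\<close>

lemma act_t:
  assumes "g \<in> carrier F" "w \<in> \<Omega>"
  shows "act (t g) (\<one>, w) = (t g, w)"
  using assms(1)
proof (induction "d g" arbitrary: g rule: less_induct)
  case less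
  show ?case
  proof (cases "t g \<in> W")
    \<comment> \<open>Here the label in \<open>act_W\<close> is trivial, since
      \<open>t (t g) = t g\<close>.\<close>
    case True
    then show ?thesis using act_W[OF True assms(2)] less.prems by simp
  next
    case False
    then obtain l where l: "fst l \<in> X" "d (inv (letter_value F l) \<otimes> g) < d g"
      "t g = letter_value F l \<otimes> t (inv (letter_value F l) \<otimes> g)"
      using t_tree[OF less.prems] by blast
    define h where "h = inv (letter_value F l) \<otimes> g"
    have x: "fst l \<in> carrier F" using l X_carrier by auto
    then have lc: "letter_value F l \<in> carrier F" by auto
    have h: "h \<in> carrier F" "g = letter_value F l \<otimes> h" "t g = letter_value F l \<otimes> t h"
      using l lc less.prems by (auto simp: h_def)
    have "d h < d g" using l(2) by (simp add: h_def)
    then have IH: "act (t h) (\<one>, w) = (t h, w)" using less.hyps h(1) by blast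
    \<comment> \<open>Proved for arbitrary \<open>x\<close>, \<open>g\<close>, \<open>h\<close>, as
      a forest edge may point towards \<open>W\<close> or away from it. The label is \<one>, so its
      tag is irrelevant.\<close>
    have triv: "act x (t h, w) = (t g, w)" if "x \<in> X" "t g = x \<otimes> t h" "h \<in> carrier F"
      "g \<in> carrier F" "g = x \<otimes> h" for x g h
    proof -
      have "edge x (t h) = \<one>"
        using X_carrier[OF that(1)] mult_t[of h x] that(2-4)
        by (simp add: edge_def m_assoc flip: that(5))
      then show ?thesis
        using that(2,3) act(2)[OF that(1), of "(t h, w)"] assms(2) by (simp add: move_def)
    qed
    have "act (letter_value F l) (t h, w) = (t g, w)"
    proof (cases "snd l")
      case True
      then show ?thesis using triv[OF l(1) _ h(1) less.prems] h(2,3) by (simp add: letter_value_def)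
    next
      case False
      then have li: "letter_value F l = inv (fst l)" by (simp add: letter_value_def)
      \<comment> \<open>The basis edge leads from \<open>g\<close> to \<open>h\<close> in this case,
        so \<open>triv\<close> is used with the two exchanged.\<close>
      have "h = fst l \<otimes> g" by (simp add: h_def li x less.prems)
      moreover have "t h = fst l \<otimes> t g" using h(3) li x h(1) by simp
      ultimately have "act (fst l) (t g, w) = (t h, w)"
        using triv[OF l(1) _ less.prems h(1)] by simp
      then show ?thesis using act_inv_act[OF x, of "(t g, w)"] less.prems assms(2) li by simp
    qed
    then show ?thesis using IH h(1) lc assms(2) unfolding h(3) by (simp add: act.composition_rule)
  qed
qed

text \<open>The label satisfies \<open>t (x \<otimes> g) \<otimes> a = x \<otimes> t g\<close>. By
  \<open>act_t\<close> the walks along representatives leave normal forms alone, so comparing the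
  two sides leaves only the edge \<open>x\<close>, which contributes \<open>a\<close> with tag
  \<open>False\<close>.\<close>

lemma regular_M: "a \<in> M \<Longrightarrow> regular False a"
proof (rule regular_generate[OF M_gens, folded M_def])
  fix a assume "a \<in> {edge x g | x g. x \<in> X \<and> g \<in> carrier F \<and> \<not> inner x g}"
  then obtain x g where a: "a = edge x g" "x \<in> X" "g \<in> carrier F" "\<not> inner x g" by auto
  have c: "x \<in> carrier F" "x \<otimes> g \<in> carrier F" "a \<in> carrier F" "a \<in> K"
    using a X_carrier edge_in_K by auto
  have aM: "a \<in> (if False then L else M)" using edge_in_factor[OF a(2,3)] a by simp
  have "act a (\<one>, w) = (a, syllable_mult F False a w)" if w: "w \<in> \<Omega>" for w
  proof -
    let ?w = "syllable_mult F False a w"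
    have w': "?w \<in> \<Omega>" using mult_closed[OF aM w] .
    have "act (t (x \<otimes> g)) (\<one> \<otimes> a, ?w) = (t (x \<otimes> g) \<otimes> a, ?w)"
      using act_shift[of "t (x \<otimes> g)" \<one> ?w a] c w' act_t[OF c(2) w'] by simp
    also have "t (x \<otimes> g) \<otimes> a = x \<otimes> t g"
      using a c by (simp add: edge_def m_assoc)
    also have "(x \<otimes> t g, ?w) = act x (t g, w)"
      using a c w by (simp add: act move_def inner_t edge_t)
    also have "\<dots> = act (x \<otimes> t g) (\<one>, w)"
      using act_t[OF a(3) w] a c w by (simp add: act.composition_rule)
    finally have "act (inv (t (x \<otimes> g))) (act (x \<otimes> t g) (\<one>, w)) = (a, ?w)"
      using act_inv_act[of "t (x \<otimes> g)" "(\<one> \<otimes> a, ?w)"] c w' by simp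
    moreover have "a = inv (t (x \<otimes> g)) \<otimes> (x \<otimes> t g)" using a c by (simp add: edge_def m_assoc)
    ultimately show ?thesis using c a(3) w by (simp add: act.composition_rule)
  qed
  then show "regular False a" using aM by (simp add: regular_def)
qed

text \<open>Syllables are applied from the right. Each is regular, and in a normal form it never
  merges with the next one, so the word is rebuilt unchanged. Membership in \<open>K\<close> is
  carried along because \<open>act_shift\<close> needs it.\<close>

lemma act_val: "w \<in> \<Omega> \<Longrightarrow> act (val w) (\<one>, []) = (val w, w) \<and> val w \<in> K"
proof (induction w)
  case Nil
  then show ?case using subgroup.one_closed[OF K] by (simp add: val_def)
next
  case (Cons u w)
  obtain b a where u: "u = syllable b a" by (rule syllable_cases)
  have a: "a \<in> (if b then L else M)" "w \<in> \<Omega>"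
    using Cons.prems unfolding u Cons_in_free_product_words_iff by auto
  have "regular b a" using a regular_L regular_M by (cases b) auto
  then have r: "act a (\<one>, w) = (a, u # w)"
    using a(2) syllable_mult_Cons_word[of b a w] Cons.prems by (simp add: regular_def u)
  have K': "val w \<in> K" "a \<in> K" using Cons.IH a L_subset M_subset by (auto split: if_splits)
  then have c: "val w \<in> carrier F" "a \<in> carrier F" using K_carrier by auto
  have v: "val (u # w) = a \<otimes> val w" by (simp add: val_def u)
  have "act (val (u # w)) (\<one>, []) = act a (\<one> \<otimes> val w, w)"
    using Cons.IH a c by (simp add: v act.composition_rule)
  also have "\<dots> = (a \<otimes> val w, u # w)"
    using act_shift[of a \<one> w "val w"] K' c a r by simp
  finally show ?case using v K' subgroup.m_closed[OF K] by simp
qed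

text \<open>The witness is the normal form that \<open>k\<close> produces from
  \<open>(\<one>, [])\<close>: it evaluates to \<open>k\<close> by \<open>val_act\<close>, as
  \<open>t k = \<one>\<close>, and by \<open>act_val\<close> every normal form of \<open>k\<close>
  equals it.\<close>

theorem free_product: "is_free_product (F\<lparr>carrier := K\<rparr>) L M"
  unfolding is_free_product_def
proof (intro conjI ballI)
  show "subgroup L (F\<lparr>carrier := K\<rparr>)" "subgroup M (F\<lparr>carrier := K\<rparr>)"
    using subgroup_incl K L_subgroup M_subgroup L_subset M_subset by auto
  fix k assume "k \<in> carrier (F\<lparr>carrier := K\<rparr>)"
  then have k: "k \<in> K" "k \<in> carrier F" using K_carrier by auto
  have "\<exists>!w. w \<in> \<Omega> \<and> val w = k"
  proof (rule ex1I[of _ "snd (act k (\<one>, []))"])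
    have "act k (\<one>, []) \<in> S" using act_closed k by simp
    then have S': "snd (act k (\<one>, [])) \<in> \<Omega>" by auto
    moreover have "val (snd (act k (\<one>, []))) = k"
      using val_act[of k \<one> "[]"] k val_closed[OF S'] by (simp add: val_def)
    ultimately show "snd (act k (\<one>, [])) \<in> \<Omega> \<and> val (snd (act k (\<one>, []))) = k" by blast
  next
    fix w assume "w \<in> \<Omega> \<and> val w = k"
    then show "w = snd (act k (\<one>, []))" using act_val[of w] by auto
  qed
  then show "\<exists>!w. w \<in> free_product_words (F\<lparr>carrier := K\<rparr>) L M \<and>
      list_prod (F\<lparr>carrier := K\<rparr>) (map (case_sum id id) w) = k"
    by (simp add: val_def free_product_words_def)
qed

end

section \<open>Finitely many candidates for the free factor\<close>

theorem (in group) finitely_many_free_factors: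
  assumes X: "free_basis G X" and A: "finite A" "A \<subseteq> carrier G"
  shows "\<exists>\<L>. finite \<L> \<and> (\<forall>L\<in>\<L>. fin_gen_subgroup L G) \<and>
    (\<forall>K. subgroup K G \<and> A \<subseteq> K \<longrightarrow> (\<exists>L\<in>\<L>. free_factor L (G\<lparr>carrier := K\<rparr>) \<and> A \<subseteq> L))"
proof -
  have X_carrier: "X \<subseteq> carrier G" using X by (simp add: free_basis_def)
  have "\<forall>a\<in>A. \<exists>w. fst ` set w \<subseteq> X \<and> a = word_value G w"
    using A free_basis_word[OF X] by (metis subsetD)
  then obtain w where w: "\<And>a. a \<in> A \<Longrightarrow> fst ` set (w a) \<subseteq> X" "\<And>a. a \<in> A \<Longrightarrow> a = word_value G (w a)"
    by metis
  \<comment> \<open>\<open>W\<close> and \<open>D\<close> are fixed before \<open>K\<close> is;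
    \<open>K\<close> only selects which elements of \<open>D\<close> generate \<open>L\<close>.
    Inserting \<one> covers the case that \<open>A\<close> is empty.\<close>
  define W where "W = insert \<one> (\<Union>a\<in>A. range (\<lambda>n. word_value G (drop n (w a))))"
  define D where "D = (\<lambda>(p, q). inv p \<otimes> q) ` (W \<times> W)"
  \<comment> \<open>\<open>drop n v\<close> is constant from \<open>length v\<close> on, so there
    are finitely many suffixes.\<close>
  have "range (\<lambda>n. word_value G (drop n v)) \<subseteq> (\<lambda>n. word_value G (drop n v)) ` {..length v}" for v
  proof (rule image_subsetI)
    fix n show "word_value G (drop n v) \<in> (\<lambda>n. word_value G (drop n v)) ` {..length v}"
      by (rule image_eqI[of _ _ "min n (length v)"]) (auto simp: min_def)
  qed
  then have "finite (range (\<lambda>n. word_value G (drop n v)))" for v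
    by (rule finite_subset) simp
  then have fin: "finite W" using A(1) by (simp add: W_def)
  have suffix: "\<exists>v. fst ` set v \<subseteq> X \<and> p = word_value G v \<and> (\<forall>n. word_value G (drop n v) \<in> W)"
    if p_W: "p \<in> W" for p
  proof (cases "p = \<one>")
    case True
    then show ?thesis by (intro exI[of _ "[]"]) (simp add: W_def)
  next
    case False
    then obtain a n where p: "a \<in> A" "p = word_value G (drop n (w a))"
      using p_W by (auto simp: W_def)
    have "fst ` set (drop n (w a)) \<subseteq> X" using w(1)[OF p(1)] set_drop_subset by fast
    moreover have "\<forall>m. word_value G (drop m (drop n (w a))) \<in> W"
      using p(1) by (auto simp: W_def)
    ultimately show ?thesis using p(2) by blast
  qed
  have one: "\<one> \<in> W" by (simp add: W_def)
  have A_W: "A \<subseteq> W"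
  proof
    fix a assume a: "a \<in> A"
    then have "a = word_value G (drop 0 (w a))" using w(2) by simp
    then show "a \<in> W" unfolding W_def using a by blast
  qed
  have W_carrier: "W \<subseteq> carrier G"
  proof
    fix p assume "p \<in> W"
    then obtain v where "fst ` set v \<subseteq> X" "p = word_value G v" using suffix by blast
    then show "p \<in> carrier G" using word_value_closed[of v] X_carrier by auto
  qed
  have D: "finite D" "D \<subseteq> carrier G"
    using fin W_carrier by (auto simp: D_def)
  show ?thesis
  proof (intro exI[of _ "generate G ` Pow D"] conjI ballI allI impI; (elim conjE)?)
    show "finite (generate G ` Pow D)" using D by simp
    show "fin_gen_subgroup L G" if "L \<in> generate G ` Pow D" for L
      using that D unfolding fin_gen_subgroup_def by (auto dest: finite_subset)
    fix K assume K_subgroup: "subgroup K G" and A_K: "A \<subseteq> K"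
    obtain t d where "coset_graph G X K W t d"
      using coset_graph_exists[OF X K_subgroup W_carrier one suffix] by blast
    then interpret coset_graph G X K W t d .
    have "A \<subseteq> L"
    proof
      fix a assume a: "a \<in> A"
      then have "inv \<one> \<otimes> a = a" "a \<in> W" "\<one> \<in> W" "a \<in> K" using A A_W A_K one_W by auto
      then show "a \<in> L" unfolding L_def by (intro generate.incl CollectI) metis
    qed
    moreover have "L \<in> generate G ` Pow D" unfolding L_def D_def by (intro imageI) auto
    moreover have "free_factor L (G\<lparr>carrier := K\<rparr>)"
      unfolding free_factor_def using free_product by blast
    ultimately show "\<exists>L\<in>generate G ` Pow D. free_factor L (G\<lparr>carrier := K\<rparr>) \<and> A \<subseteq> L" by blast
  qed
qed

section \<open>Closures\<close>

lemma is_closure_cl: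
  assumes "admits_closure \<P> H" shows "is_closure \<P> H (cl \<P> H)"
proof -
  obtain C where C: "is_closure \<P> H C" using assms by (auto simp: admits_closure_def)
  moreover have "C' = C" if "is_closure \<P> H C'" for C'
    using that C by (intro equalityI) (auto simp: is_closure_def)
  ultimately show ?thesis unfolding cl_def by (rule theI)
qed

text \<open>The family need only reach below every member of \<open>\<P>\<close> above
  \<open>H\<close>. This allows all such members when \<open>\<P>\<close> is intersection closed and
  a finite family in the finitely generated case.\<close>

lemma is_closure_Inter:
  assumes "\<A> \<subseteq> \<P>" "\<Inter>\<A> \<in> \<P>" "\<And>K. K \<in> \<A> \<Longrightarrow> H \<subseteq> K"
    and "\<And>K. K \<in> \<P> \<Longrightarrow> H \<subseteq> K \<Longrightarrow> \<exists>L\<in>\<A>. L \<subseteq> K"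
  shows "is_closure \<P> H (\<Inter>\<A>)"
  using assms unfolding is_closure_def by blast

lemma free_factor_subset: "free_factor L (F\<lparr>carrier := K\<rparr>) \<Longrightarrow> L \<subseteq> K"
  unfolding free_factor_def is_free_product_def using subgroup.subset by fastforce

theorem proposition4p1:
  fixes F :: "('a, 'b) monoid_scheme" and \<P> :: "'a set set"
  assumes "free_group F" and "abstract_property F \<P>"
  shows
    "(intersection_closed \<P> \<longrightarrow> (\<forall>H. subgroup H F \<longrightarrow> admits_closure \<P> H)) \<and>
     (finite_intersection_closed \<P> \<and> free_factor_closed F \<P> \<longrightarrow>
        (\<forall>H. subgroup H F \<and> fin_gen_subgroup H F \<longrightarrow> admits_closure \<P> H)) \<and>
     (closures_well_defined F \<P> \<and> free_factor_closed F \<P> \<longrightarrow>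
        (\<forall>H. subgroup H F \<longrightarrow>
           algebraic_extension H (F\<lparr>carrier := cl \<P> H\<rparr>) \<and>
           (fin_gen_subgroup H F \<longrightarrow> fin_gen_subgroup (cl \<P> H) F)))"
proof (intro conjI impI allI; (elim conjE)?)
  obtain X where "group F" and X: "free_basis F X"
    using assms(1) by (auto simp: free_group_def)
  then interpret group F by simp
  have P_subgroup: "subgroup K F" if "K \<in> \<P>" for K
    using assms(2) that by (auto simp: abstract_property_def)
  have F_P: "carrier F \<in> \<P>" using assms(2) by (simp add: abstract_property_def)
  fix H assume H: "subgroup H F"
  have H_carrier: "H \<subseteq> carrier F" using H by (rule subgroup.subset)
  show "admits_closure \<P> H" if "intersection_closed \<P>"
  proof -
    have "{K\<in>\<P>. H \<subseteq> K} \<subseteq> \<P>" "{K\<in>\<P>. H \<subseteq> K} \<noteq> {}" using F_P H_carrier by auto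
    then have "\<Inter>{K\<in>\<P>. H \<subseteq> K} \<in> \<P>"
      using that unfolding intersection_closed_def by blast
    then have "is_closure \<P> H (\<Inter>{K\<in>\<P>. H \<subseteq> K})" by (intro is_closure_Inter) auto
    then show ?thesis unfolding admits_closure_def by (rule exI)
  qed
  \<comment> \<open>Free factor closedness puts the chosen free factors into \<open>\<P>\<close>.
    The finiteness of the list serves the existence of closures, that of generation the last
    claim.\<close>
  have takahasi: "\<exists>\<L>. finite \<L> \<and> (\<forall>L\<in>\<L>. fin_gen_subgroup L F) \<and>
     (\<forall>K\<in>\<P>. H \<subseteq> K \<longrightarrow> (\<exists>L\<in>\<L>. free_factor L (F\<lparr>carrier := K\<rparr>) \<and> L \<in> \<P> \<and> H \<subseteq> L))"
    if fg: "fin_gen_subgroup H F" and ff: "free_factor_closed F \<P>"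
  proof -
    obtain A where A: "finite A" "A \<subseteq> carrier F" "H = generate F A"
      using fg by (auto simp: fin_gen_subgroup_def)
    from finitely_many_free_factors[OF X A(1,2)]
    obtain \<L> where \<L>: "finite \<L>" "\<forall>L\<in>\<L>. fin_gen_subgroup L F"
      "\<forall>K. subgroup K F \<and> A \<subseteq> K \<longrightarrow> (\<exists>L\<in>\<L>. free_factor L (F\<lparr>carrier := K\<rparr>) \<and> A \<subseteq> L)"
      by (elim exE conjE)
    have "\<exists>L\<in>\<L>. free_factor L (F\<lparr>carrier := K\<rparr>) \<and> L \<in> \<P> \<and> H \<subseteq> L" if "K \<in> \<P>" and HK: "H \<subseteq> K" for K
    proof -
      have "A \<subseteq> K" using HK generate.incl[of _ A F] unfolding A(3) by blast
      then obtain L where L: "L \<in> \<L>" "free_factor L (F\<lparr>carrier := K\<rparr>)" "A \<subseteq> L"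
        using \<L>(3) P_subgroup \<open>K \<in> \<P>\<close> by blast
      then have "L \<in> \<P>" using ff \<open>K \<in> \<P>\<close> by (auto simp: free_factor_closed_def)
      then have "H \<subseteq> L" unfolding A(3) using L(3) P_subgroup by (intro generate_subgroup_incl)
      then show ?thesis using L \<open>L \<in> \<P>\<close> by blast
    qed
    then show ?thesis using \<L>(1,2) by (intro exI[of _ \<L>]) simp
  qed
  show "admits_closure \<P> H"
    if fg: "fin_gen_subgroup H F" and fic: "finite_intersection_closed \<P>"
      and ff: "free_factor_closed F \<P>"
  proof -
    from takahasi[OF fg ff] obtain \<L> where \<L>: "finite \<L>"
      "\<forall>K\<in>\<P>. H \<subseteq> K \<longrightarrow> (\<exists>L\<in>\<L>. free_factor L (F\<lparr>carrier := K\<rparr>) \<and> L \<in> \<P> \<and> H \<subseteq> L)"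
      by (elim exE conjE) (rule that)
    let ?\<A> = "{L\<in>\<L>. L \<in> \<P> \<and> H \<subseteq> L}"
    \<comment> \<open>Applied to \<open>F\<close> itself this also shows that the finite family is
      nonempty.\<close>
    have below: "\<exists>L\<in>?\<A>. L \<subseteq> K" if K: "K \<in> \<P>" "H \<subseteq> K" for K
    proof -
      obtain L where "L \<in> \<L>" "free_factor L (F\<lparr>carrier := K\<rparr>)" "L \<in> \<P>" "H \<subseteq> L"
        using \<L>(2) K by blast
      then show ?thesis using free_factor_subset by blast
    qed
    have "?\<A> \<noteq> {}" using below[OF F_P H_carrier] by blast
    moreover have "finite ?\<A>" "?\<A> \<subseteq> \<P>" using \<L>(1) by auto
    ultimately have Inter: "\<Inter>?\<A> \<in> \<P>"
      using fic unfolding finite_intersection_closed_def by blast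
    have "is_closure \<P> H (\<Inter>?\<A>)"
      by (rule is_closure_Inter[OF _ Inter _ below]) auto
    then show ?thesis unfolding admits_closure_def by (rule exI)
  qed
  assume cwd: "closures_well_defined F \<P>" and ff: "free_factor_closed F \<P>"
  have cl: "cl \<P> H \<in> \<P>" "H \<subseteq> cl \<P> H" "\<And>K. K \<in> \<P> \<Longrightarrow> H \<subseteq> K \<Longrightarrow> cl \<P> H \<subseteq> K"
    using cwd H is_closure_cl[of \<P> H] by (auto simp: closures_well_defined_def is_closure_def)
  \<comment> \<open>A free factor of the closure satisfies \<open>\<P>\<close>; if it contains
    \<open>H\<close>, minimality forces it to be the whole closure.\<close>
  have least: "cl \<P> H \<subseteq> L" if "free_factor L (F\<lparr>carrier := cl \<P> H\<rparr>)" "H \<subseteq> L" for L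
    using ff cl that by (auto simp: free_factor_closed_def)
  show "algebraic_extension H (F\<lparr>carrier := cl \<P> H\<rparr>)"
    unfolding algebraic_extension_def algebraic_element_def
    using subgroup_incl[OF H P_subgroup[OF cl(1)] cl(2)] least by auto
  show "fin_gen_subgroup (cl \<P> H) F" if fg: "fin_gen_subgroup H F"
  proof -
    \<comment> \<open>The closure is itself a member of \<open>\<P>\<close> above \<open>H\<close>,
      so it has a finitely generated free factor containing \<open>H\<close>, with which it
      coincides by \<open>least\<close>.\<close>
    obtain L where L: "fin_gen_subgroup L F" "free_factor L (F\<lparr>carrier := cl \<P> H\<rparr>)" "H \<subseteq> L"
      using takahasi[OF fg ff] cl(1,2) by blast
    have "cl \<P> H = L" using least[OF L(2,3)] free_factor_subset[OF L(2)] by (rule equalityI)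
    then show ?thesis using L(1) by simp
  qed
qed

end
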